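(* Let $1\le s\le n$ be integers. Then the number of $[s]$-restricted parking functions on $n$ cars is $$\#\mathrm{PF}_{n\mid[s]}=s^{n}-\sum_{i=0}^{s-1}\binom{n}{i}(i+1)^{i-1}(s-i-1)^{n-i}.$$
   Context: $[m]=\{1,\dots,m\}$. A parking function on $n$ cars is a function $\pi:[n]\to[n]$ such that $\#\pi^{-1}([i])\ge i$ for every $i\in[n]$. For $S\subseteq[n]$, $\mathrm{PF}_{n\mid S}$ is the set of $S$-restricted parking functions on $n$ cars: parking functions on $n$ cars with image contained in $S$. In the $i=0$ term, $(i+1)^{i-1}=1^{-1}=1$. *)

theory Defs
  imports Complex_Main "HOL-Library.FuncSet"
begin

text \<open>
  A function \<open>[n] \<rightarrow> [n]\<close> is an element of the extensional function space \<open>\<rightarrow>\<^sub>E\<close>, so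
  that two functions agreeing on \<open>[n]\<close> are equal and the sets below are finite.
\<close>

definition parking_function :: "nat \<Rightarrow> (nat \<Rightarrow> nat) \<Rightarrow> bool" where
  "parking_function n \<pi> \<longleftrightarrow>
     \<pi> \<in> {1..n} \<rightarrow>\<^sub>E {1..n} \<and> (\<forall>i\<in>{1..n}. card (\<pi> -` {1..i} \<inter> {1..n}) \<ge> i)"

definition PF_restricted :: "nat \<Rightarrow> nat set \<Rightarrow> (nat \<Rightarrow> nat) set" where
  "PF_restricted n S = {\<pi>. parking_function n \<pi> \<and> \<pi> ` {1..n} \<subseteq> S}"

end

theory Submission
  imports Defs
begin

text \<open>
  A function \<open>[n] \<rightarrow> [s]\<close> that violates the parking condition first fails it at some position
  \<open>i + 1 \<le> s\<close>. Then exactly \<open>i\<close> cars prefer a spot in \<open>[i]\<close>, they form a parking function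
  on \<open>i\<close> cars, no car prefers \<open>i + 1\<close>, and the other \<open>n - i\<close> cars choose freely among the
  remaining \<open>s - i - 1\<close> spots. Counting by \<open>i\<close> gives the formula once the number of parking
  functions on \<open>i\<close> cars is known to be \<open>(i + 1)\<^bsup>i - 1\<^esup>\<close>. For \<open>s = n + 1\<close> every function
  fails, so the same decomposition is a recurrence for that number, and Abel's binomial
  identity solves it.
\<close>

section \<open>Abel's identity\<close>

text \<open>Up to sign this is an \<open>n\<close>-th finite difference of a polynomial of degree
  \<open>m < n\<close>. Splitting off one factor \<open>x + of_nat i\<close> leaves the induction
  hypothesis times \<open>x\<close>, plus a sum in which absorption of \<open>i\<close> lowers
  \<open>n\<close> by one.\<close>

lemma alternating_binomial_sum_power_eq_0:
  fixes x :: "'a :: comm_ring_1"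
  assumes "m < n"
  shows "(\<Sum>i\<le>n. (-1) ^ i * of_nat (n choose i) * (x + of_nat i) ^ m) = 0"
  using assms
proof (induction m arbitrary: n x)
  case 0
  then show ?case by (simp add: choose_alternating_sum)
next
  case (Suc m)
  then obtain k where n: "n = Suc k" "m < k" by (cases n) auto
  let ?t = "\<lambda>n x i. (-1) ^ i * of_nat (n choose i) * (x + of_nat i) ^ m :: 'a"
  have absorb: "of_nat i * of_nat (n choose i) = (of_nat n * of_nat (k choose (i - 1)) :: 'a)"
    if "i > 0" for i
  proof -
    have "i * (n choose i) = n * (k choose (i - 1))"
      using that n Suc_times_binomial_eq[of k "i - 1"] by simp
    then show ?thesis by (simp only: flip: of_nat_mult)
  qed
  have "(\<Sum>i\<le>n. of_nat i * ?t n x i) = (\<Sum>i\<le>k. of_nat (Suc i) * ?t n x (Suc i))"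
    by (simp add: n sum.atMost_Suc_shift del: sum.atMost_Suc)
  \<comment> \<open>After the index shift the base \<open>x + (i + 1)\<close> is read as
    \<open>(x + 1) + i\<close>, hence the generalisation over \<open>x\<close>; the sign comes from
    \<open>(-1) ^ Suc i\<close>.\<close>
  also have "\<dots> = (\<Sum>i\<le>k. - of_nat n * ?t k (x + 1) i)"
  proof (rule sum.cong)
    fix i
    have "of_nat (Suc i) * ?t n x (Suc i)
      = (of_nat (Suc i) * of_nat (n choose Suc i)) * ((-1) ^ Suc i * (x + of_nat (Suc i)) ^ m)"
      by (simp add: ac_simps)
    also have "\<dots> = - of_nat n * ?t k (x + 1) i"
      by (subst absorb) (simp_all add: ac_simps)
    finally show "of_nat (Suc i) * ?t n x (Suc i) = - of_nat n * ?t k (x + 1) i" .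
  qed simp
  also have "\<dots> = 0"
    unfolding sum_distrib_left[symmetric] by (simp add: Suc.IH[OF n(2)])
  finally have *: "(\<Sum>i\<le>n. of_nat i * ?t n x i) = 0" .
  have "(\<Sum>i\<le>n. (-1) ^ i * of_nat (n choose i) * (x + of_nat i) ^ Suc m)
      = x * (\<Sum>i\<le>n. ?t n x i) + (\<Sum>i\<le>n. of_nat i * ?t n x i)"
    unfolding sum_distrib_left sum.distrib[symmetric]
    by (rule sum.cong) (simp_all add: algebra_simps)
  also have "\<dots> = 0"
    using * Suc.IH[of n x] Suc.prems by simp
  finally show ?case .
qed

text \<open>
  Abel's identity at \<open>x = 1\<close>. The truncated subtraction in the exponent is harmless, since
  \<open>i = 0\<close> gives \<open>1\<^sup>0\<close>. Both sides have the same derivative in \<open>y\<close> by induction,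
  and they agree at \<open>y = -1\<close>.
\<close>
lemma abel_identity:
  fixes y :: real
  shows "(\<Sum>i\<le>n. real (n choose i) * (1 + real i) ^ (i - 1) * (y - real i) ^ (n - i)) = (1 + y) ^ n"
proof (induction n arbitrary: y)
  case 0
  then show ?case by simp
next
  case (Suc n)
  define A where "A n y = (\<Sum>i\<le>n. real (n choose i) * (1 + real i) ^ (i - 1) * (y - real i) ^ (n - i))"
    for n :: nat and y :: real
  have choose: "real (Suc n choose i) * real (Suc n - i) = real (Suc n) * real (n choose i)"
    if "i \<le> n" for i
    using binomial_absorb_comp[of "Suc n" i]
    by (metis diff_Suc_1 mult.commute of_nat_mult)
  have deriv: "(A (Suc n) has_real_derivative real (Suc n) * A n y) (at y)" for y
  proof -
    have "(A (Suc n) has_real_derivative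
        (\<Sum>i\<le>Suc n. real (Suc n choose i) * (1 + real i) ^ (i - 1) *
          (real (Suc n - i) * (y - real i) ^ (Suc n - i - 1)))) (at y)"
      unfolding A_def by (auto intro!: derivative_eq_intros sum.cong)
    \<comment> \<open>The term \<open>i = Suc n\<close> is constant in \<open>y\<close>: its factor
      \<open>Suc n - i\<close> is 0.\<close>
    also have "(\<Sum>i\<le>Suc n. real (Suc n choose i) * (1 + real i) ^ (i - 1) *
          (real (Suc n - i) * (y - real i) ^ (Suc n - i - 1)))
      = (\<Sum>i\<le>n. real (Suc n choose i) * (1 + real i) ^ (i - 1) *
          (real (Suc n - i) * (y - real i) ^ (Suc n - i - 1)))"
      by simp
    also have "\<dots> = (\<Sum>i\<le>n. (real (Suc n choose i) * real (Suc n - i)) * (1 + real i) ^ (i - 1) *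
          (y - real i) ^ (n - i))"
      by (rule sum.cong) (simp_all add: ac_simps)
    also have "\<dots> = (\<Sum>i\<le>n. real (Suc n) * real (n choose i) * (1 + real i) ^ (i - 1) *
          (y - real i) ^ (n - i))"
      by (rule sum.cong[OF refl]) (simp only: choose atMost_iff)
    also have "\<dots> = real (Suc n) * A n y"
      by (simp add: A_def sum_distrib_left ac_simps)
    finally show ?thesis .
  qed
  have "((\<lambda>y. A (Suc n) y - (1 + y) ^ Suc n) has_real_derivative 0) (at y)" for y
  proof -
    have "((\<lambda>y. (1 + y) ^ Suc n) has_real_derivative real (Suc n) * A n y) (at y)"
      using Suc.IH[of y] by (auto intro!: derivative_eq_intros simp: A_def simp del: power_Suc)
    from DERIV_diff[OF deriv this] show ?thesis by simp
  qed
  then have const: "A (Suc n) y - (1 + y) ^ Suc n = A (Suc n) (-1) - (1 + (-1)) ^ Suc n"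
    using DERIV_isconst_all by blast
  \<comment> \<open>At \<open>y = -1\<close> the base \<open>y - i\<close> is
    \<open>-(1 + i)\<close>, so the two powers merge into one of exponent \<open>n\<close>, just
    below the range \<open>Suc n\<close> of the alternating sum.\<close>
  have term_eq: "real (Suc n choose i) * (1 + real i) ^ (i - 1) * (-1 - real i) ^ (Suc n - i)
      = (-1) ^ Suc n * ((-1) ^ i * real (Suc n choose i) * (1 + real i) ^ n)"
    if "i \<le> Suc n" for i
  proof -
    have neg: "(-1 - real i) ^ (Suc n - i) = (-1) ^ (Suc n - i) * (1 + real i) ^ (Suc n - i)"
      by (metis minus_add_distrib power_minus uminus_add_conv_diff diff_conv_add_uminus)
    have sign: "(-1 :: real) ^ (Suc n - i) = (-1) ^ Suc n * (-1) ^ i"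
      using that by (simp add: minus_one_power_iff)
    \<comment> \<open>For \<open>i = 0\<close> the exponents add up to \<open>Suc n\<close> instead
      of \<open>n\<close>, but the base is 1.\<close>
    have pow: "(1 + real i) ^ (i - 1) * (1 + real i) ^ (Suc n - i) = (1 + real i) ^ n"
      using that by (cases i) (simp_all flip: power_add)
    have "real (Suc n choose i) * (1 + real i) ^ (i - 1) * (-1 - real i) ^ (Suc n - i)
        = real (Suc n choose i) * (-1) ^ (Suc n - i) *
          ((1 + real i) ^ (i - 1) * (1 + real i) ^ (Suc n - i))"
      unfolding neg by (simp only: ac_simps)
    also have "\<dots> = (-1) ^ Suc n * ((-1) ^ i * real (Suc n choose i) * (1 + real i) ^ n)"
      unfolding pow sign by (simp only: ac_simps)
    finally show ?thesis .
  qed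
  have "A (Suc n) (-1)
      = (\<Sum>i\<le>Suc n. (-1) ^ Suc n * ((-1) ^ i * real (Suc n choose i) * (1 + real i) ^ n))"
    unfolding A_def by (rule sum.cong[OF refl]) (simp only: term_eq atMost_iff)
  also have "\<dots> = 0"
    unfolding sum_distrib_left[symmetric]
    by (subst alternating_binomial_sum_power_eq_0) simp_all
  finally show ?case using const by (simp add: A_def)
qed

section \<open>First failure decomposition\<close>

text \<open>
  With an arbitrary finite set \<open>A\<close> of cars, the parking functions are \<open>ballot A (card A)\<close>.
\<close>
definition ballot :: "'a set \<Rightarrow> nat \<Rightarrow> ('a \<Rightarrow> nat) set" where
  "ballot A s = {\<pi> \<in> A \<rightarrow>\<^sub>E {1..s}. \<forall>j\<in>{1..s}. j \<le> card {a \<in> A. \<pi> a \<le> j}}"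

text \<open>\<open>B\<close> consists of the cars with a preference before the first failure, at
  \<open>card B + 1\<close>; nobody prefers that spot, so the other cars start at
  \<open>card B + 2\<close>. Indexing by the set instead of its size makes each class a
  product.\<close>

definition first_failure :: "'a set \<Rightarrow> nat \<Rightarrow> 'a set \<Rightarrow> ('a \<Rightarrow> nat) set" where
  "first_failure A s B =
    {\<pi> \<in> A \<rightarrow>\<^sub>E {1..s}. restrict \<pi> B \<in> ballot B (card B) \<and> \<pi> ` (A - B) \<subseteq> {card B + 2..s}}"

lemma finite_ballot: "finite A \<Longrightarrow> finite (ballot A s)"
  unfolding ballot_def by (rule finite_subset[of _ "A \<rightarrow>\<^sub>E {1..s}"]) (auto intro: finite_PiE)

lemma finite_first_failure: "finite A \<Longrightarrow> finite (first_failure A s B)"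
  unfolding first_failure_def by (rule finite_subset[of _ "A \<rightarrow>\<^sub>E {1..s}"]) (auto intro: finite_PiE)

text \<open>The condition at the last position asks for more cars than there are. This turns the
  decomposition below into a recurrence.\<close>

lemma ballot_Suc_card_eq_empty:
  assumes "finite A"
  shows "ballot A (Suc (card A)) = {}"
proof -
  have "card {a \<in> A. \<pi> a \<le> j} \<le> card A" for \<pi> :: "'a \<Rightarrow> nat" and j
    using assms by (intro card_mono) auto
  then have "\<not> Suc (card A) \<le> card {a \<in> A. \<pi> a \<le> Suc (card A)}" for \<pi> :: "'a \<Rightarrow> nat"
    by (simp add: not_le less_Suc_eq_le)
  moreover have "Suc (card A) \<in> {1..Suc (card A)}" by simp
  ultimately show ?thesis unfolding ballot_def by blast
qed

text \<open>The restrictions to \<open>B\<close> and to \<open>A - B\<close> can be chosen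
  independently, and gluing them inverts the splitting.\<close>

lemma card_first_failure:
  assumes "finite A" "B \<subseteq> A" "card B < s"
  shows "card (first_failure A s B)
    = card (ballot B (card B)) * (s - card B - 1) ^ (card A - card B)"
proof -
  let ?i = "card B"
  let ?R = "ballot B ?i \<times> ((A - B) \<rightarrow>\<^sub>E {?i + 2..s})"
  let ?f = "\<lambda>\<pi>. (restrict \<pi> B, restrict \<pi> (A - B))"
  let ?g = "\<lambda>(\<sigma>, \<tau>). restrict (\<lambda>a. if a \<in> B then \<sigma> a else \<tau> a :: nat) A"
  have "bij_betw ?f (first_failure A s B) ?R"
  proof (rule bij_betw_byWitness[where f' = ?g])
    show "\<forall>\<pi>\<in>first_failure A s B. ?g (?f \<pi>) = \<pi>"
      by (auto simp: first_failure_def fun_eq_iff PiE_def extensional_def)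
    show "\<forall>p\<in>?R. ?f (?g p) = p"
      using assms(2) by (auto simp: ballot_def fun_eq_iff PiE_def extensional_def)
    show "?f ` first_failure A s B \<subseteq> ?R"
      by (auto simp: first_failure_def)
    show "?g ` ?R \<subseteq> first_failure A s B"
    proof (rule image_subsetI)
      fix p assume "p \<in> ?R"
      then obtain \<sigma> \<tau> where p: "p = (\<sigma>, \<tau>)"
        and \<sigma>: "\<sigma> \<in> ballot B ?i" and \<tau>: "\<tau> \<in> (A - B) \<rightarrow>\<^sub>E {?i + 2..s}"
        by blast
      have \<sigma>': "1 \<le> \<sigma> a" "\<sigma> a \<le> ?i" if "a \<in> B" for a
        using \<sigma> that by (auto simp: ballot_def PiE_iff)
      have \<tau>': "?i + 2 \<le> \<tau> a" "\<tau> a \<le> s" if "a \<in> A - B" for a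
        using \<tau> that by (auto simp: PiE_iff)
      have "restrict (?g (\<sigma>, \<tau>)) B = \<sigma>"
        using \<sigma> assms(2) by (auto simp: ballot_def fun_eq_iff PiE_def extensional_def)
      moreover have "?g (\<sigma>, \<tau>) \<in> A \<rightarrow>\<^sub>E {1..s}"
        using \<sigma>' \<tau>' assms(3) by (fastforce intro: order.trans)
      ultimately show "?g p \<in> first_failure A s B"
        using \<sigma> \<tau>' by (auto simp: p first_failure_def)
    qed
  qed
  then have "card (first_failure A s B) = card ?R"
    by (rule bij_betw_same_card)
  \<comment> \<open>For \<open>s = ?i + 1\<close> no spot is left; the factor is then 0 unless
    \<open>B = A\<close>, where \<open>0 ^ 0 = 1\<close> counts the empty function.\<close>
  also have "\<dots> = card (ballot B ?i) * (s - ?i - 1) ^ card (A - B)"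
    using assms by (simp add: card_cartesian_product card_PiE)
  finally show ?thesis
    using assms by (simp add: card_Diff_subset finite_subset)
qed

text \<open>Cars in \<open>B\<close> stay within \<open>card B\<close> and the others skip
  \<open>card B + 1\<close>. So \<open>B\<close> can be read off from \<open>\<pi>\<close> and its
  size, and the first violation is at \<open>card B + 1\<close>.\<close>

lemma first_failure_below:
  assumes "finite A" "B \<subseteq> A" "\<pi> \<in> first_failure A s B"
  shows "{a \<in> A. \<pi> a \<le> Suc (card B)} = B"
    and "\<And>j. j \<in> {1..card B} \<Longrightarrow> j \<le> card {a \<in> A. \<pi> a \<le> j}"
proof -
  have B: "\<pi> a \<le> card B" if "a \<in> B" for a
    using that assms(3) by (auto simp: first_failure_def ballot_def PiE_iff)
  have notB: "card B + 2 \<le> \<pi> a" if "a \<in> A" "a \<notin> B" for a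
    using that assms(3) by (auto simp: first_failure_def)
  show "{a \<in> A. \<pi> a \<le> Suc (card B)} = B"
    using B notB assms(2) by fastforce
  fix j assume "j \<in> {1..card B}"
  then have "j \<le> card {a \<in> B. restrict \<pi> B a \<le> j}"
    using assms(3) by (auto simp: first_failure_def ballot_def)
  also have "\<dots> \<le> card {a \<in> A. \<pi> a \<le> j}"
    using assms by (intro card_mono) auto
  finally show "j \<le> card {a \<in> A. \<pi> a \<le> j}" .
qed

lemma first_failure_inject:
  assumes "finite A" "B \<subseteq> A" "C \<subseteq> A"
    and "\<pi> \<in> first_failure A s B" "\<pi> \<in> first_failure A s C"
  shows "B = C"
proof -
  \<comment> \<open>If \<open>card B < card C\<close>, the condition at \<open>Suc (card B)\<close>
    holds by the class of \<open>C\<close>, while the class of \<open>B\<close> leaves only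
    \<open>card B\<close> cars there.\<close>
  have le: "card C \<le> card B"
    if "B \<subseteq> A" "C \<subseteq> A" "\<pi> \<in> first_failure A s B" "\<pi> \<in> first_failure A s C" for B C
    using first_failure_below(1)[OF assms(1) that(1,3)]
      first_failure_below(2)[OF assms(1) that(2,4), of "Suc (card B)"]
    by (cases "card C \<le> card B") auto
  have card: "card B = card C"
    using le[OF assms(2-5)] le[OF assms(3,2,5,4)] by (rule le_antisym[rotated])
  have "B = {a \<in> A. \<pi> a \<le> Suc (card B)}"
    by (rule first_failure_below(1)[OF assms(1,2,4), symmetric])
  also have "\<dots> = C"
    unfolding card by (rule first_failure_below(1)[OF assms(1,3,5)])
  finally show ?thesis .
qed

lemma not_ballot_imp_first_failure:
  assumes "finite A" "\<pi> \<in> A \<rightarrow>\<^sub>E {1..s}" "\<pi> \<notin> ballot A s"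
  obtains B where "B \<subseteq> A" "card B < s" "\<pi> \<in> first_failure A s B"
proof -
  define P where "P j \<longleftrightarrow> j \<in> {1..s} \<and> card {a \<in> A. \<pi> a \<le> j} < j" for j
  define k where "k = (LEAST j. P j)"
  have "\<exists>j. P j"
    using assms unfolding P_def ballot_def by (auto simp del: atLeastAtMost_iff simp: not_le)
  then have "P k" unfolding k_def by (rule LeastI_ex)
  then obtain i where i: "k = Suc i" by (cases k) (auto simp: P_def)
  have min: "j \<le> card {a \<in> A. \<pi> a \<le> j}" if "j \<in> {1..i}" for j
  proof -
    have "\<not> P j" using not_less_Least[of j P] that i by (auto simp: k_def)
    then show ?thesis using that i \<open>P k\<close> by (auto simp: P_def)
  qed
  define B where "B = {a \<in> A. \<pi> a \<le> i}"
  have "B \<subseteq> A" by (auto simp: B_def)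
  have sub: "B \<subseteq> {a \<in> A. \<pi> a \<le> Suc i}" by (auto simp: B_def)
  have fin: "finite {a \<in> A. \<pi> a \<le> Suc i}" using assms(1) by simp
  have up: "card {a \<in> A. \<pi> a \<le> Suc i} \<le> i"
    using \<open>P k\<close> i by (simp add: P_def)
  \<comment> \<open>Minimality of \<open>k\<close> bounds \<open>card B\<close> below by
    \<open>i\<close>, and failure at \<open>i + 1\<close> bounds the larger set above by
    \<open>i\<close>. Hence the two sets coincide and no car prefers \<open>i + 1\<close>.\<close>
  have "i \<le> card B"
    using min[of i] by (cases "i = 0") (auto simp: B_def)
  moreover have "card B \<le> card {a \<in> A. \<pi> a \<le> Suc i}"
    using sub fin by (rule card_mono[rotated])
  ultimately have card: "card B = i" "card B = card {a \<in> A. \<pi> a \<le> Suc i}"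
    using up by auto
  have B_eq: "B = {a \<in> A. \<pi> a \<le> Suc i}"
    using card_subset_eq[OF fin sub card(2)] .
  have big: "i + 2 \<le> \<pi> a" if "a \<in> A - B" for a
    using that B_eq by (auto simp: not_le)
  have "{a \<in> B. restrict \<pi> B a \<le> j} = {a \<in> A. \<pi> a \<le> j}" if "j \<in> {1..i}" for j
    using that by (auto simp: B_def)
  then have "restrict \<pi> B \<in> ballot B (card B)"
    using min assms(2) card(1) by (auto simp: ballot_def B_def PiE_iff)
  then have "\<pi> \<in> first_failure A s B"
    using assms(2) big card(1) by (auto simp: first_failure_def PiE_iff)
  moreover have "card B < s"
    using \<open>P k\<close> i card(1) by (simp add: P_def)
  ultimately show thesis using that \<open>B \<subseteq> A\<close> by blast
qed

text \<open>The first-failure classes with \<open>card B < s\<close> partition the functions outside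
  \<open>ballot A s\<close>; their sizes are then grouped by \<open>card B\<close>.\<close>

lemma card_ballot_decomposition:
  assumes "finite A"
  shows "s ^ card A = card (ballot A s) +
    (\<Sum>i<s. \<Sum>B | B \<subseteq> A \<and> card B = i.
       card (ballot B i) * (s - i - 1) ^ (card A - i))"
proof -
  let ?I = "{B. B \<subseteq> A \<and> card B < s}"
  have finI: "finite ?I" by (rule finite_subset[of _ "Pow A"]) (use assms in auto)
  have eq: "A \<rightarrow>\<^sub>E {1..s} = ballot A s \<union> (\<Union>B\<in>?I. first_failure A s B)"
  proof
    show "A \<rightarrow>\<^sub>E {1..s} \<subseteq> ballot A s \<union> (\<Union>B\<in>?I. first_failure A s B)"
    proof
      fix \<pi> assume \<pi>: "\<pi> \<in> A \<rightarrow>\<^sub>E {1..s}"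
      show "\<pi> \<in> ballot A s \<union> (\<Union>B\<in>?I. first_failure A s B)"
      proof (cases "\<pi> \<in> ballot A s")
        case False
        from not_ballot_imp_first_failure[OF assms \<pi> this] show ?thesis by blast
      qed simp
    qed
    have "ballot A s \<subseteq> A \<rightarrow>\<^sub>E {1..s}" "first_failure A s B \<subseteq> A \<rightarrow>\<^sub>E {1..s}" for B
      unfolding ballot_def first_failure_def by (rule Collect_restrict)+
    then show "ballot A s \<union> (\<Union>B\<in>?I. first_failure A s B) \<subseteq> A \<rightarrow>\<^sub>E {1..s}"
      by (intro Un_least UN_least)
  qed
  have disj: "ballot A s \<inter> first_failure A s B = {}" if "B \<in> ?I" for B
  proof (rule equals0I)
    fix \<pi> assume "\<pi> \<in> ballot A s \<inter> first_failure A s B"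
    then have \<pi>: "\<pi> \<in> ballot A s" "\<pi> \<in> first_failure A s B" by simp_all
    have "Suc (card B) \<le> card {a \<in> A. \<pi> a \<le> Suc (card B)}"
      using that \<pi>(1) by (simp add: ballot_def)
    moreover have "{a \<in> A. \<pi> a \<le> Suc (card B)} = B"
      using that by (intro first_failure_below(1)[OF assms _ \<pi>(2)]) simp
    ultimately show False by (metis Suc_n_not_le_n)
  qed
  have "s ^ card A = card (A \<rightarrow>\<^sub>E {1..s})"
    using assms by (simp add: card_PiE)
  also have "\<dots> = card (ballot A s) + card (\<Union>B\<in>?I. first_failure A s B)"
    unfolding eq using disj assms finI
    by (intro card_Un_disjoint) (auto simp: finite_ballot finite_first_failure)
  also have "card (\<Union>B\<in>?I. first_failure A s B) = (\<Sum>B\<in>?I. card (first_failure A s B))"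
    using assms finI first_failure_inject[OF assms]
    by (intro card_UN_disjoint) (auto simp: finite_first_failure)
  also have "\<dots> = (\<Sum>B\<in>?I. card (ballot B (card B)) * (s - card B - 1) ^ (card A - card B))"
    using assms by (intro sum.cong) (auto simp: card_first_failure)
  also have "\<dots> = (\<Sum>i<s. \<Sum>B | B \<in> ?I \<and> card B = i.
      card (ballot B (card B)) * (s - card B - 1) ^ (card A - card B))"
    using finI by (intro sum.group[symmetric]) auto
  also have "\<dots> = (\<Sum>i<s. \<Sum>B | B \<subseteq> A \<and> card B = i.
       card (ballot B i) * (s - i - 1) ^ (card A - i))"
    by (intro sum.cong) auto
  finally show ?thesis .
qed

section \<open>The number of parking functions\<close>

theorem card_ballot_card:
  assumes "finite A"
  shows "card (ballot A (card A)) = (card A + 1) ^ (card A - 1)"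
  using assms
proof (induction "card A" arbitrary: A rule: less_induct)
  case less
  let ?n = "card A"
  have "(?n + 1) ^ ?n = (\<Sum>i<Suc ?n. \<Sum>B | B \<subseteq> A \<and> card B = i.
       card (ballot B i) * (?n - i) ^ (?n - i))"
    using card_ballot_decomposition[OF less.prems, of "Suc ?n"]
      ballot_Suc_card_eq_empty[OF less.prems] by simp
  \<comment> \<open>The top term \<open>i = ?n\<close> comes from \<open>B = A\<close> alone and, as
    \<open>0 ^ 0 = 1\<close>, is the unknown count; the induction hypothesis covers all smaller
    \<open>i\<close>.\<close>
  also have "\<dots> = (\<Sum>i<?n. \<Sum>B | B \<subseteq> A \<and> card B = i. card (ballot B i) * (?n - i) ^ (?n - i))
      + (\<Sum>B | B \<subseteq> A \<and> card B = ?n. card (ballot B ?n))"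
    by simp
  also have "{B. B \<subseteq> A \<and> card B = ?n} = {A}"
    using less.prems by (auto dest: card_subset_eq)
  also have "(\<Sum>i<?n. \<Sum>B | B \<subseteq> A \<and> card B = i. card (ballot B i) * (?n - i) ^ (?n - i))
      = (\<Sum>i<?n. \<Sum>B | B \<subseteq> A \<and> card B = i. (i + 1) ^ (i - 1) * (?n - i) ^ (?n - i))"
  proof (intro sum.cong refl)
    fix i B assume "i \<in> {..<?n}" "B \<in> {B. B \<subseteq> A \<and> card B = i}"
    then show "card (ballot B i) * (?n - i) ^ (?n - i) = (i + 1) ^ (i - 1) * (?n - i) ^ (?n - i)"
      using less.hyps[of B] less.prems by (auto simp: finite_subset)
  qed
  also have "\<dots> = (\<Sum>i<?n. (?n choose i) * (i + 1) ^ (i - 1) * (?n - i) ^ (?n - i))"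
    using less.prems by (simp add: n_subsets mult.assoc)
  finally have rec: "(?n + 1) ^ ?n = (\<Sum>i<?n. (?n choose i) * (i + 1) ^ (i - 1) * (?n - i) ^ (?n - i))
      + card (ballot A ?n)"
    by simp
  \<comment> \<open>Abel's identity at \<open>y = ?n\<close> has the same left side and the same
    terms for \<open>i < ?n\<close>, so its top term \<open>(?n + 1) ^ (?n - 1)\<close> must be the
    unknown count.\<close>
  have "real ((?n + 1) ^ ?n) = (\<Sum>i\<le>?n. real (?n choose i) * (1 + real i) ^ (i - 1) * (real ?n - real i) ^ (?n - i))"
    unfolding abel_identity by (simp add: add.commute)
  also have "\<dots> = real (\<Sum>i\<le>?n. (?n choose i) * (i + 1) ^ (i - 1) * (?n - i) ^ (?n - i))"
    unfolding of_nat_sum by (intro sum.cong) (simp_all add: of_nat_diff add.commute)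
  finally have "(?n + 1) ^ ?n = (\<Sum>i\<le>?n. (?n choose i) * (i + 1) ^ (i - 1) * (?n - i) ^ (?n - i))"
    by (simp only: of_nat_eq_iff)
  then show ?case
    using rec by (simp flip: lessThan_Suc_atMost)
qed

section \<open>The count of restricted parking functions\<close>

lemma PF_restricted_eq_ballot:
  assumes "s \<le> n"
  shows "PF_restricted n {1..s} = ballot {1..n} s"
proof -
  have vimage: "\<pi> -` {1..j} \<inter> {1..n} = {a \<in> {1..n}. \<pi> a \<le> j}"
    if "\<pi> \<in> {1..n} \<rightarrow>\<^sub>E {1..m}" for \<pi> :: "nat \<Rightarrow> nat" and j m
    using that by (auto simp: PiE_iff)
  show ?thesis
  proof (intro set_eqI iffI)
    fix \<pi> assume "\<pi> \<in> PF_restricted n {1..s}"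
    then have \<pi>: "\<pi> \<in> {1..n} \<rightarrow>\<^sub>E {1..n}" "\<pi> ` {1..n} \<subseteq> {1..s}"
        "\<forall>j\<in>{1..n}. j \<le> card (\<pi> -` {1..j} \<inter> {1..n})"
      by (auto simp: PF_restricted_def parking_function_def)
    then show "\<pi> \<in> ballot {1..n} s"
      using assms vimage[OF \<pi>(1)] by (auto simp: ballot_def PiE_iff image_subset_iff)
  next
    fix \<pi> assume \<pi>: "\<pi> \<in> ballot {1..n} s"
    then have P: "\<pi> \<in> {1..n} \<rightarrow>\<^sub>E {1..s}" by (simp add: ballot_def)
    have "j \<le> card {a \<in> {1..n}. \<pi> a \<le> j}" if "j \<in> {1..n}" for j
    proof (cases "j \<le> s")
      case True
      then show ?thesis using \<pi> that by (auto simp: ballot_def)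
    next
      \<comment> \<open>Beyond \<open>s\<close> every car is counted, so the condition reduces to
        \<open>j \<le> n\<close>.\<close>
      case False
      then have "{a \<in> {1..n}. \<pi> a \<le> j} = {1..n}"
        using P by (force simp: PiE_iff)
      then show ?thesis using that by simp
    qed
    then show "\<pi> \<in> PF_restricted n {1..s}"
      using P assms vimage[OF P]
      by (fastforce simp: PF_restricted_def parking_function_def PiE_iff)
  qed
qed

theorem theorem7:
  fixes s n :: nat
  assumes "1 \<le> s" and "s \<le> n"
  shows "real (card (PF_restricted n {1..s})) =
    real s ^ n -
      (\<Sum>i = 0..s - 1. real (n choose i) * (real i + 1) powi (int i - 1)
                        * (real s - real i - 1) ^ (n - i))"
proof -
  have "s ^ n = card (ballot {1..n} s) +
      (\<Sum>i<s. \<Sum>B | B \<subseteq> {1..n} \<and> card B = i. card (ballot B i) * (s - i - 1) ^ (n - i))"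
    using card_ballot_decomposition[of "{1..n}" s] by simp
  also have "(\<Sum>i<s. \<Sum>B | B \<subseteq> {1..n} \<and> card B = i. card (ballot B i) * (s - i - 1) ^ (n - i))
      = (\<Sum>i<s. \<Sum>B | B \<subseteq> {1..n} \<and> card B = i. (i + 1) ^ (i - 1) * (s - i - 1) ^ (n - i))"
    by (intro sum.cong) (auto simp: finite_subset card_ballot_card)
  also have "\<dots> = (\<Sum>i<s. (n choose i) * (i + 1) ^ (i - 1) * (s - i - 1) ^ (n - i))"
    by (simp add: n_subsets mult.assoc)
  finally have "real (s ^ n) = real (card (ballot {1..n} s) +
      (\<Sum>i<s. (n choose i) * (i + 1) ^ (i - 1) * (s - i - 1) ^ (n - i)))"
    by (rule arg_cong)
  moreover have "real (\<Sum>i<s. (n choose i) * (i + 1) ^ (i - 1) * (s - i - 1) ^ (n - i))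
      = (\<Sum>i = 0..s - 1. real (n choose i) * (real i + 1) powi (int i - 1)
                        * (real s - real i - 1) ^ (n - i))"
    unfolding of_nat_sum
  proof (rule sum.cong)
    show "{..<s} = {0..s - 1}" using assms(1) by auto
    fix i assume "i \<in> {0..s - 1}"
    then have "real (s - i - 1) = real s - real i - 1"
      using assms(1) by (auto simp: of_nat_diff)
    \<comment> \<open>At \<open>i = 0\<close> the exponents differ, 0 on the left and -1 on the
      right, but the base is 1.\<close>
    moreover have "real ((i + 1) ^ (i - 1)) = (real i + 1) powi (int i - 1)"
      by (cases i) (simp_all add: power_int_def add.commute)
    ultimately show "real ((n choose i) * (i + 1) ^ (i - 1) * (s - i - 1) ^ (n - i))
        = real (n choose i) * (real i + 1) powi (int i - 1) * (real s - real i - 1) ^ (n - i)"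
      by simp
  qed
  ultimately show ?thesis
    using PF_restricted_eq_ballot[OF assms(2)] by simp
qed

end
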